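(* Let $\Delta$ be an ideal triangle in $\mathbb{H}^2$ and $B_1,B_2,B_3$ be horoballs, one centered at each ideal vertex of $\Delta$. For $i\in\{1,2,3\}$, let $\theta_i$ be the length of the horocyclic arc $S_i\cap\Delta$, where $S_i=\partial B_i$, and for each $i<j$ let $d_{ij}$ be the signed distance between $B_i$ and $B_j$ along the geodesic joining their centers (with a negative sign if the horoballs overlap). Then: \begin{itemize} \item (Law of Sines) $\displaystyle \frac{\theta_1}{e^{d_{23}}} = \frac{\theta_2}{e^{d_{13}}} = \frac{\theta_3}{e^{d_{12}}}$; \item (First Law of Cosines) $\displaystyle \theta_1 = \sqrt{\frac{e^{d_{23}}}{e^{d_{12}}e^{d_{13}}}}$; \item (Second Law of Cosines) $\displaystyle e^{d_{23}} = \frac{1}{\theta_2\theta_3}$. \end{itemize}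
   Context: $\mathbb{H}^2$ is the hyperbolic plane. An ideal triangle is a triangle in $\mathbb{H}^2$ all three of whose vertices are ideal points. The center of a horoball is its ideal point, and its boundary is the horosphere (in $\mathbb{H}^2$, the horocycle) with the same ideal point. The signed distance between two horoballs with distinct centers is the distance between their boundary horocycles along the geodesic joining their centers, taken with a negative sign if the horoballs overlap.
   Formalization: If a horoball is so large that its horocycle S_i crosses the opposite side, S_i∩Δ is two pieces and the laws fail for its length; there θ_i is taken as the length of the full horocyclic arc between the two sides ending at the center. Otherwise the arc is S_i∩Δ itself. *)

theory Defs
  imports "HOL-Analysis.Analysis" "HOL-Real_Asymp.Real_Asymp"
begin

text \<open>
  The hyperbolic plane is taken in the hyperboloid model: the upper sheet of
  \<open>\<langle>x, x\<rangle> = -1\<close> in Minkowski space of signature \<open>(2,1)\<close>. A vector is a pair of its time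
  coordinate and its two space coordinates.
\<close>

type_synonym minkowski = "real \<times> (real ^ 2)"

definition lorentz :: "minkowski \<Rightarrow> minkowski \<Rightarrow> real"
  where "lorentz x y = snd x \<bullet> snd y - fst x * fst y"

definition hyp_plane :: "minkowski set"
  where "hyp_plane = {x. lorentz x x = -1 \<and> fst x > 0}"

definition hyp_dist :: "minkowski \<Rightarrow> minkowski \<Rightarrow> real"
  where "hyp_dist x y = arcosh (- lorentz x y)"

text \<open>
  The Riemannian metric is the restriction of the Lorentz form to tangent vectors of the
  hyperboloid, where it is positive definite. At the finitely many break points of a valid
  path the integrand has an arbitrary value, which does not affect the integral.
\<close>

definition hyp_length :: "(real \<Rightarrow> minkowski) \<Rightarrow> real"
  where "hyp_length g =
    integral {0..1} (\<lambda>t. sqrt (lorentz (vector_derivative g (at t)) (vector_derivative g (at t))))"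

text \<open>
  The length of a set that is the image of a simple piecewise smooth path; the length of such
  a set does not depend on the parametrisation.
\<close>

definition hyp_arc_length :: "minkowski set \<Rightarrow> real"
  where "hyp_arc_length A =
    (THE l. \<exists>g. arc g \<and> valid_path g \<and> path_image g = A \<and> hyp_length g = l)"

definition lightlike :: "minkowski \<Rightarrow> bool"
  where "lightlike n \<longleftrightarrow> lorentz n n = 0 \<and> fst n > 0"

text \<open>Ideal points are the open rays of the future light cone.\<close>

definition ideal_point :: "minkowski set \<Rightarrow> bool"
  where "ideal_point \<xi> \<longleftrightarrow> (\<exists>n. lightlike n \<and> \<xi> = {t *\<^sub>R n | t. t > 0})"

text \<open>The geodesic joining two distinct ideal points: the plane they span meets the hyperboloid.\<close>

definition geodesic_line :: "minkowski set \<Rightarrow> minkowski set \<Rightarrow> minkowski set"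
  where "geodesic_line \<xi> \<eta> = hyp_plane \<inter> span (\<xi> \<union> \<eta>)"

text \<open>
  The hyperbolic convex hull is obtained by projecting the linear convex hull, which is a cone,
  to the hyperboloid.
\<close>

definition ideal_triangle :: "minkowski set \<Rightarrow> minkowski set \<Rightarrow> minkowski set \<Rightarrow> minkowski set"
  where "ideal_triangle \<xi> \<eta> \<zeta> = hyp_plane \<inter> convex hull (\<xi> \<union> \<eta> \<union> \<zeta>)"

text \<open>
  Every horoball centered at the ray \<open>\<xi>\<close> is given by exactly one light-like vector on \<open>\<xi>\<close>.
  By the lemma below this is the family of sublevel sets of the Busemann functions of \<open>\<xi>\<close>.
\<close>

definition horoball :: "minkowski set \<Rightarrow> minkowski set \<Rightarrow> bool"
  where "horoball \<xi> B \<longleftrightarrow> (\<exists>n\<in>\<xi>. B = {x \<in> hyp_plane. - lorentz x n \<le> 1})"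

lemma lorentz_lightlike_neg:
  assumes x: "x \<in> hyp_plane" and n: "lightlike n"
  shows "lorentz x n < 0"
proof -
  have fx: "fst x > 0" and fn: "fst n > 0"
    using x n by (auto simp: hyp_plane_def lightlike_def)
  have "norm (snd n) ^ 2 = fst n ^ 2"
    using n by (simp add: lightlike_def lorentz_def power2_norm_eq_inner) (simp add: power2_eq_square)
  hence 1: "norm (snd n) = fst n" using fn by (simp add: power2_eq_iff_nonneg)
  have "norm (snd x) ^ 2 < fst x ^ 2"
    using x by (simp add: hyp_plane_def lorentz_def power2_norm_eq_inner) (simp add: power2_eq_square)
  hence 2: "norm (snd x) < fst x" using fx by (simp add: power_less_imp_less_base)
  have "snd x \<bullet> snd n \<le> norm (snd x) * norm (snd n)" by (rule norm_cauchy_schwarz)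
  also have "\<dots> < fst x * fst n" using 1 2 fn by simp
  finally show ?thesis by (simp add: lorentz_def)
qed

lemma busemann_lightlike:
  fixes p n x :: minkowski
  defines "ray \<equiv> \<lambda>t::real. exp (- t) *\<^sub>R p + sinh t *\<^sub>R n"
  assumes p: "p \<in> hyp_plane" and x: "x \<in> hyp_plane"
    and n: "lightlike n" "lorentz p n = -1"
  shows "((\<lambda>t. hyp_dist x (ray t) - hyp_dist p (ray t)) \<longlongrightarrow> ln (- lorentz x n)) at_top"
proof -
  define a b where "a = - lorentz x p" and "b = - lorentz x n"
  have b: "b > 0" using lorentz_lightlike_neg[OF x n(1)] by (simp add: b_def)
  have e: "- lorentz x (ray t) = exp (-t) * a + sinh t * b" for t
    by (simp add: ray_def lorentz_def a_def b_def algebra_simps)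
  have pp: "lorentz p p = -1" using p by (simp add: hyp_plane_def)
  have e': "- lorentz p (ray t) = exp (-t) + sinh t" for t
  proof -
    have "lorentz p (ray t) = exp (-t) * lorentz p p + sinh t * lorentz p n"
      by (simp add: ray_def lorentz_def algebra_simps)
    thus ?thesis using pp n(2) by simp
  qed
  have "((\<lambda>t::real. arcosh (exp (-t) * a + sinh t * b) - arcosh (exp (-t) + sinh t))
     \<longlongrightarrow> ln b) at_top"
    using b unfolding arcosh_def sinh_def by simp real_asymp
  thus ?thesis unfolding hyp_dist_def e e' b_def .
qed

text \<open>
  The horocycle bounding a horoball is its topological boundary relative to the hyperbolic plane.
\<close>

definition horocycle :: "minkowski set \<Rightarrow> minkowski set"
  where "horocycle B = top_of_set hyp_plane frontier_of B"

text \<open>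
  The horocyclic arc that a triangle \<open>D\<close> cuts out of a horocycle \<open>S\<close>: the smallest connected part
  of \<open>S\<close> containing \<open>S \<inter> D\<close>. It equals \<open>S \<inter> D\<close> whenever the latter is connected, i.e. an arc. If
  the horoball is so large that \<open>S\<close> crosses the side opposite to its center, then \<open>S \<inter> D\<close> consists
  of two pieces; the arc is then the one between the two sides that end at the center.
\<close>

definition horocyclic_arc :: "minkowski set \<Rightarrow> minkowski set \<Rightarrow> minkowski set"
  where "horocyclic_arc S D = \<Inter> {C. connected C \<and> C \<subseteq> S \<and> S \<inter> D \<subseteq> C}"

lemma horocyclic_arc_eq_Int: "connected (S \<inter> D) \<Longrightarrow> horocyclic_arc S D = S \<inter> D"
  unfolding horocyclic_arc_def by blast

text \<open>
  The geodesic joining the centers meets each of the two horocycles in one point, so the infimum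
  is the distance of these two points. Horoballs that are merely tangent meet as well, but then
  this distance is 0 and the sign is immaterial.
\<close>

definition signed_horoball_dist ::
    "minkowski set \<Rightarrow> minkowski set \<Rightarrow> minkowski set \<Rightarrow> minkowski set \<Rightarrow> real"
  where "signed_horoball_dist \<xi> B \<eta> C =
    (let d = Inf {hyp_dist p q | p q.
               p \<in> horocycle B \<inter> geodesic_line \<xi> \<eta> \<and> q \<in> horocycle C \<inter> geodesic_line \<xi> \<eta>}
     in if B \<inter> C = {} then d else - d)"

end

theory Submission
  imports Defs
begin

text \<open>
  Let \<open>n\<^sub>i\<close> be the light-like vector that describes \<open>B\<^sub>i\<close> and put \<open>a\<^sub>i\<^sub>j = - \<langle>n\<^sub>i, n\<^sub>j\<rangle>\<close>. The horocycle of
  \<open>B\<^sub>1\<close> meets the side towards \<open>\<xi>\<^sub>2\<close> in \<open>p = n\<^sub>1/2 + n\<^sub>2/a\<^sub>1\<^sub>2\<close> and the side towards \<open>\<xi>\<^sub>3\<close> in \<open>q = n\<^sub>1/2 + n\<^sub>3/a\<^sub>1\<^sub>3\<close>,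
  and a computation with such points gives \<open>exp d\<^sub>i\<^sub>j = a\<^sub>i\<^sub>j/2\<close>. A horocycle is a parabola
  \<open>p + u v + u\<^sup>2 k\<close> with \<open>k\<close> a multiple of \<open>n\<^sub>1\<close>, traversed with constant speed \<open>T = |v|\<close>; if \<open>q\<close> is
  reached at \<open>u = 1\<close>, then \<open>\<langle>p, q\<rangle> = -1 - T\<^sup>2/2\<close>. Hence \<open>\<theta>\<^sub>1 = T = \<surd>(2 a\<^sub>2\<^sub>3/(a\<^sub>1\<^sub>2 a\<^sub>1\<^sub>3))\<close>, and all three laws
  follow by algebra.
\<close>

section \<open>The Lorentz form, light-like vectors and ideal points\<close>

lemma bounded_bilinear_lorentz: "bounded_bilinear lorentz"
proof
  have "norm (lorentz x y) \<le> norm x * norm y * 2" for x y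
  proof -
    have "\<bar>snd x \<bullet> snd y\<bar> \<le> norm (snd x) * norm (snd y)"
      by (rule Cauchy_Schwarz_ineq2)
    also have "\<dots> \<le> norm x * norm y"
      using norm_snd_le[of "snd x" "fst x"] norm_snd_le[of "snd y" "fst y"]
      by (simp add: mult_mono)
    finally have "\<bar>snd x \<bullet> snd y\<bar> \<le> norm x * norm y" .
    moreover have "\<bar>fst x * fst y\<bar> \<le> norm x * norm y"
      using norm_fst_le[of "fst x" "snd x"] norm_fst_le[of "fst y" "snd y"]
      by (simp add: abs_mult mult_mono)
    ultimately show ?thesis by (simp add: lorentz_def)
  qed
  thus "\<exists>K. \<forall>x y. norm (lorentz x y) \<le> norm x * norm y * K" by blast
qed (simp_all add: lorentz_def algebra_simps)

interpretation lorentz: bounded_bilinear lorentz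
  by (rule bounded_bilinear_lorentz)

lemmas lorentz_algebra = lorentz.add_left lorentz.add_right lorentz.diff_left lorentz.diff_right
  lorentz.scaleR_left lorentz.scaleR_right lorentz.minus_left lorentz.minus_right

lemma lorentz_commute: "lorentz x y = lorentz y x"
  by (simp add: lorentz_def inner_commute mult.commute)

text \<open>Lets any vector of an ideal point act as its generator, in particular the one that
  determines a horoball.\<close>

lemma ideal_point_eq_ray:
  assumes "ideal_point \<xi>" "n \<in> \<xi>"
  shows "lightlike n" "\<xi> = {t *\<^sub>R n | t. t > 0}"
proof -
  obtain m where m: "lightlike m" "\<xi> = {t *\<^sub>R m | t. t > 0}"
    using assms by (auto simp: ideal_point_def)
  then obtain s where s: "n = s *\<^sub>R m" "s > 0" using assms by auto
  show "lightlike n" using m(1) s by (simp add: lightlike_def lorentz_algebra)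
  have "\<exists>r. t *\<^sub>R m = r *\<^sub>R n \<and> r > 0" if "t > 0" for t
    using s that by (intro exI[of _ "t / s"]) auto
  moreover have "\<exists>r. t *\<^sub>R n = r *\<^sub>R m \<and> r > 0" if "t > 0" for t
    using s that by (intro exI[of _ "t * s"]) auto
  ultimately show "\<xi> = {t *\<^sub>R n | t. t > 0}" unfolding m(2) by blast
qed

lemma lightlike_fst:
  assumes "lightlike n"
  shows "fst n = norm (snd n)" "fst n > 0"
proof -
  have "norm (snd n) ^ 2 = fst n ^ 2"
    using assms by (simp add: lightlike_def lorentz_def power2_norm_eq_inner)
      (simp add: power2_eq_square)
  thus "fst n = norm (snd n)" "fst n > 0"
    using assms by (auto simp: power2_eq_iff_nonneg lightlike_def)
qed

text \<open>The time coordinate of a light-like vector is the norm of its space part, so the claim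
  is a strict Cauchy-Schwarz inequality. Equality would make the space parts, hence the vectors,
  positive multiples of each other, and the two rays would coincide.\<close>

lemma lorentz_ideal_points_neg:
  assumes "ideal_point \<xi>" "ideal_point \<eta>" "\<xi> \<noteq> \<eta>" "n \<in> \<xi>" "m \<in> \<eta>"
  shows "lorentz n m < 0"
proof (rule ccontr)
  assume "\<not> lorentz n m < 0"
  note n = ideal_point_eq_ray[OF assms(1,4)] and m = ideal_point_eq_ray[OF assms(2,5)]
  have "snd n \<bullet> snd m \<ge> norm (snd n) * norm (snd m)"
    using \<open>\<not> lorentz n m < 0\<close> n(1) m(1) by (simp add: lorentz_def lightlike_fst)
  hence "snd n \<bullet> snd m = norm (snd n) * norm (snd m)"
    using norm_cauchy_schwarz[of "snd n" "snd m"] by linarith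
  hence e: "fst n *\<^sub>R snd m = fst m *\<^sub>R snd n"
    using n(1) m(1) by (simp add: norm_cauchy_schwarz_eq lightlike_fst)
  have "m = (1 / fst n) *\<^sub>R (fst n *\<^sub>R m)"
    using lightlike_fst(2)[OF n(1)] by simp
  also have "fst n *\<^sub>R m = fst m *\<^sub>R n"
    using e by (simp add: prod_eq_iff mult.commute)
  finally have "m = (fst m / fst n) *\<^sub>R n" by simp
  moreover have "fst m / fst n > 0"
    using lightlike_fst(2)[OF n(1)] lightlike_fst(2)[OF m(1)] by simp
  ultimately have "m \<in> \<xi>" unfolding n(2) by blast
  from ideal_point_eq_ray(2)[OF assms(1) this] m(2) assms(3) show False by simp
qed

lemma lightlike_combination_in_hyp_plane:
  assumes "lightlike n" "lightlike m" "s \<ge> 0" "t \<ge> 0" "2 * s * t * (- lorentz n m) = 1"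
  shows "s *\<^sub>R n + t *\<^sub>R m \<in> hyp_plane"
proof -
  have "s > 0 \<or> t > 0" using assms by (cases "s = 0") auto
  hence "fst (s *\<^sub>R n + t *\<^sub>R m) > 0"
    using assms(3,4) lightlike_fst(2)[OF assms(1)] lightlike_fst(2)[OF assms(2)]
    by (auto intro: add_pos_nonneg add_nonneg_pos)
  thus ?thesis using assms
    by (simp add: hyp_plane_def lightlike_def lorentz_algebra lorentz_commute[of m n])
qed

section \<open>Horocycles and the signed distance of horoballs\<close>

text \<open>The sublevel set is closed and the strict one open, so the frontier lies in the level
  set. Conversely, a point of the level set is not interior, since the geodesic through it away from
  the center leaves the horoball at once.\<close>

lemma horocycle_horoball:
  assumes "lightlike n"
  shows "horocycle {x \<in> hyp_plane. - lorentz x n \<le> 1} = {x \<in> hyp_plane. lorentz x n = -1}"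
    (is "horocycle ?B = ?S")
proof
  have cont: "continuous_on A (\<lambda>x. - lorentz x n)" for A
    by (intro continuous_intros lorentz.continuous_on)
  have cl: "closed {x. - lorentz x n \<le> 1}" and op: "open {x. - lorentz x n < 1}"
    by (rule closed_Collect_le[OF cont continuous_on_const],
        rule open_Collect_less[OF cont continuous_on_const])
  have "?B = hyp_plane \<inter> {x. - lorentz x n \<le> 1}" by auto
  hence "closedin (top_of_set hyp_plane) ?B"
    using closedin_closed_Int[OF cl, of hyp_plane] by (simp only:)
  hence outer: "horocycle ?B \<subseteq> ?B"
    unfolding horocycle_def by (rule frontier_of_subset_closedin)
  have inner: "hyp_plane \<inter> {x. - lorentz x n < 1}
      \<subseteq> top_of_set hyp_plane interior_of ?B"
    by (rule interior_of_maximal[OF _ openin_open_Int[OF op]]) auto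
  have "x \<in> ?S" if "x \<in> horocycle ?B" for x
  proof -
    have "x \<in> ?B" using that outer by blast
    moreover have "x \<notin> hyp_plane \<inter> {x. - lorentz x n < 1}"
      using that inner unfolding horocycle_def frontier_of_def by blast
    ultimately have "x \<in> hyp_plane" "- lorentz x n \<le> 1" "\<not> - lorentz x n < 1" by blast+
    thus ?thesis by simp
  qed
  thus "horocycle ?B \<subseteq> ?S" by blast
next
  show "?S \<subseteq> horocycle ?B"
  proof
    fix x assume x: "x \<in> ?S"
    hence "x \<in> top_of_set hyp_plane closure_of ?B"
      using closure_of_subset[of ?B "top_of_set hyp_plane"] by auto
    moreover have "x \<notin> top_of_set hyp_plane interior_of ?B"
    proof
      assume "x \<in> top_of_set hyp_plane interior_of ?B"
      then obtain T where T: "open T" "x \<in> T" "hyp_plane \<inter> T \<subseteq> ?B"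
        unfolding interior_of_def openin_open by auto
      \<comment> \<open>the unit speed geodesic through \<open>x\<close> that recedes from the center of the horoball\<close>
      define y where "y = (\<lambda>s::real. exp s *\<^sub>R x - sinh s *\<^sub>R n)"
      have "(y \<longlongrightarrow> exp 0 *\<^sub>R x - sinh 0 *\<^sub>R n) (at_right 0)"
        unfolding y_def by (intro tendsto_intros)
      hence lim: "(y \<longlongrightarrow> x) (at_right 0)" by simp
      have "\<forall>\<^sub>F s in at_right 0. y s \<in> T"
        using topological_tendstoD[OF lim] T by blast
      moreover have "\<forall>\<^sub>F s in at_right 0. fst (y s) > 0"
        using x order_tendstoD(1)[OF tendsto_fst[OF lim]] by (auto simp: hyp_plane_def)
      ultimately have "\<forall>\<^sub>F s in at_right 0. s > 0 \<and> y s \<in> T \<and> fst (y s) > 0"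
        using eventually_at_right_less by eventually_elim auto
      then obtain s where s: "s > 0" "y s \<in> T" "fst (y s) > 0"
        using eventually_happens'[OF trivial_limit_at_right_real] by blast
      have "lorentz (y s) (y s) = - exp s * exp s + 2 * exp s * sinh s"
        using x assms
        by (simp add: y_def lorentz_algebra lorentz_commute[of n x] hyp_plane_def lightlike_def
            algebra_simps)
      also have "\<dots> = -1"
        by (simp add: sinh_def exp_minus field_simps)
      finally have ys: "y s \<in> hyp_plane" using s by (simp add: hyp_plane_def)
      moreover have "- lorentz (y s) n = exp s"
        using x assms by (simp add: y_def lorentz_algebra lightlike_def)
      moreover have "- lorentz (y s) n \<le> 1" using T(3) s(2) ys by blast
      ultimately have "exp s \<le> 1" by linarith
      thus False using s by simp
    qed
    ultimately show "x \<in> horocycle ?B" by (simp add: horocycle_def frontier_of_def)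
  qed
qed

text \<open>On the plane of the geodesic write \<open>x = s n + t m\<close> and
  \<open>a = - lorentz n m\<close>. The horocycle condition reads \<open>t * a = 1\<close> and the
  hyperboloid condition \<open>2 * s * t * a = 1\<close>, which leaves one solution.\<close>

lemma horocycle_inter_geodesic_line:
  assumes "ideal_point \<xi>" "ideal_point \<eta>" "\<xi> \<noteq> \<eta>" "n \<in> \<xi>" "m \<in> \<eta>"
  shows "horocycle {x \<in> hyp_plane. - lorentz x n \<le> 1} \<inter> geodesic_line \<xi> \<eta>
    = {(1/2) *\<^sub>R n + (1 / - lorentz n m) *\<^sub>R m}" (is "_ = {?p}")
proof -
  define a where "a = - lorentz n m"
  have a: "a > 0" using lorentz_ideal_points_neg[OF assms] by (simp add: a_def)
  have nm: "lorentz n m = -a" "lorentz m n = -a" by (simp_all add: a_def lorentz_commute)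
  note n = ideal_point_eq_ray[OF assms(1,4)] and m = ideal_point_eq_ray[OF assms(2,5)]
  have nn: "lorentz n n = 0" "lorentz m m = 0" using n(1) m(1) by (auto simp: lightlike_def)
  have sp: "span (\<xi> \<union> \<eta>) = span {n, m}"
  proof (rule span_eq[THEN iffD2], intro conjI)
    show "\<xi> \<union> \<eta> \<subseteq> span {n, m}"
    proof
      fix x assume "x \<in> \<xi> \<union> \<eta>"
      then obtain t where "x = t *\<^sub>R n \<or> x = t *\<^sub>R m" using n(2) m(2) by blast
      thus "x \<in> span {n, m}" by (auto simp: span_base span_scale)
    qed
    show "{n, m} \<subseteq> span (\<xi> \<union> \<eta>)" using assms(4,5) by (auto intro: span_base)
  qed
  have "?p \<in> hyp_plane"
    using a n(1) m(1) by (intro lightlike_combination_in_hyp_plane) (auto simp: a_def)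
  moreover have "?p \<in> span {n, m}"
    by (intro span_add span_scale span_base) auto
  moreover have "lorentz ?p n = -1" using a by (simp add: lorentz_algebra nn nm)
  moreover have "x = ?p" if x: "x \<in> hyp_plane" "lorentz x n = -1" "x \<in> span {n, m}" for x
  proof -
    obtain s where "x - s *\<^sub>R n \<in> span {m}"
      using x(3) by (auto simp only: span_breakdown_eq)
    then obtain t where "x - s *\<^sub>R n = t *\<^sub>R m" unfolding span_singleton by blast
    hence st: "x = s *\<^sub>R n + t *\<^sub>R m" by (simp add: diff_eq_eq add.commute)
    have t: "t * a = 1" using x(2) by (simp add: st lorentz_algebra nn nm)
    have "2 * s * (t * a) = 1"
      using x(1) by (simp add: st hyp_plane_def lorentz_algebra nn nm mult_ac)
    hence "s = 1/2" using t by simp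
    moreover have "t = 1 / a" using t a by (simp add: field_simps)
    ultimately show ?thesis by (simp add: st a_def)
  qed
  ultimately show ?thesis
    unfolding horocycle_horoball[OF n(1)] geodesic_line_def sp by blast
qed

text \<open>The reversed Cauchy-Schwarz inequality: the time coordinate is the root of 1 plus the
  squared norm of the space part, and (u w + 1)^2 \<le> (1 + u^2)(1 + w^2).\<close>

lemma lorentz_le_hyp_plane:
  assumes "x \<in> hyp_plane" "y \<in> hyp_plane"
  shows "lorentz x y \<le> -1"
proof -
  have *: "fst z = sqrt (1 + norm (snd z) ^ 2)" if "z \<in> hyp_plane" for z
  proof (rule real_sqrt_unique[symmetric])
    show "fst z ^ 2 = 1 + norm (snd z) ^ 2"
      using that by (simp add: hyp_plane_def lorentz_def power2_norm_eq_inner)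
        (simp add: power2_eq_square)
    show "fst z \<ge> 0" using that by (simp add: hyp_plane_def)
  qed
  have "snd x \<bullet> snd y + 1 \<le> norm (snd x) * norm (snd y) + 1"
    using norm_cauchy_schwarz by simp
  also have "\<dots> \<le> fst x * fst y"
  proof -
    have "(norm (snd x) * norm (snd y) + 1)\<^sup>2
        \<le> (1 + norm (snd x) ^ 2) * (1 + norm (snd y) ^ 2)"
      using sum_squares_bound[of "norm (snd x)" "norm (snd y)"]
      by (simp add: power_mult_distrib power2_sum algebra_simps)
    thus ?thesis unfolding *[OF assms(1)] *[OF assms(2)]
        real_sqrt_mult[symmetric] by (rule real_le_rsqrt)
  qed
  finally show ?thesis by (simp add: lorentz_def)
qed

text \<open>The points \<open>p\<close> and \<open>q\<close> in which the geodesic meets the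
  horocycles have distance \<open>\<bar>ln (a / 2)\<bar>\<close>. The sign convention removes the
  absolute value, because the horoballs are disjoint exactly when \<open>a > 2\<close>.\<close>

lemma exp_signed_horoball_dist:
  assumes "ideal_point \<xi>" "ideal_point \<eta>" "\<xi> \<noteq> \<eta>" "n \<in> \<xi>" "m \<in> \<eta>"
  shows "exp (signed_horoball_dist \<xi> {x \<in> hyp_plane. - lorentz x n \<le> 1}
    \<eta> {x \<in> hyp_plane. - lorentz x m \<le> 1}) = - lorentz n m / 2"
    (is "exp (signed_horoball_dist \<xi> ?B \<eta> ?C) = _")
proof -
  define a where "a = - lorentz n m"
  have a: "a > 0" using lorentz_ideal_points_neg[OF assms] by (simp add: a_def)
  have nm: "lorentz n m = -a" "lorentz m n = -a" by (simp_all add: a_def lorentz_commute)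
  have ln: "lightlike n" "lightlike m" using assms ideal_point_eq_ray(1) by blast+
  hence nn: "lorentz n n = 0" "lorentz m m = 0" by (auto simp: lightlike_def)
  define p where "p = (1/2) *\<^sub>R n + (1 / a) *\<^sub>R m"
  define q where "q = (1/2) *\<^sub>R m + (1 / a) *\<^sub>R n"
  have p: "horocycle ?B \<inter> geodesic_line \<xi> \<eta> = {p}"
    using horocycle_inter_geodesic_line[OF assms] by (simp add: p_def a_def)
  have "geodesic_line \<xi> \<eta> = geodesic_line \<eta> \<xi>" by (simp add: geodesic_line_def Un_commute)
  hence q: "horocycle ?C \<inter> geodesic_line \<xi> \<eta> = {q}"
    using horocycle_inter_geodesic_line[OF assms(2,1) _ assms(5,4)] assms(3)
    by (simp add: q_def nm)
  have "- lorentz p q = (a / 2 + inverse (a / 2)) / 2"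
    using a by (simp add: p_def q_def lorentz_algebra nn nm field_simps)
  also have "\<dots> = cosh \<bar>ln (a / 2)\<bar>"
    using a by (simp add: cosh_ln_real)
  finally have dpq: "hyp_dist p q = \<bar>ln (a / 2)\<bar>"
    unfolding hyp_dist_def by (simp only: arcosh_cosh_real abs_ge_zero)
  have Inf: "Inf {hyp_dist p q | p q. p \<in> horocycle ?B \<inter> geodesic_line \<xi> \<eta>
      \<and> q \<in> horocycle ?C \<inter> geodesic_line \<xi> \<eta>} = \<bar>ln (a / 2)\<bar>"
    (is "Inf ?D = _")
  proof -
    have "?D = {hyp_dist p q}" unfolding p q by blast
    thus ?thesis by (simp add: dpq)
  qed
  \<comment> \<open>This factor normalises \<open>n + m\<close> to the midpoint of \<open>p\<close>
    and \<open>q\<close>, the point that decides whether the horoballs meet.\<close>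
  define s where "s = 1 / sqrt (2 * a)"
  have s: "s > 0" "s\<^sup>2 = 1 / (2 * a)" using a by (simp_all add: s_def power_divide)
  have "2 * s * s * a = 2 * s\<^sup>2 * a" by (simp only: power2_eq_square mult.assoc)
  also have "\<dots> = 1" unfolding s(2) using a by simp
  finally have mid: "s *\<^sub>R n + s *\<^sub>R m \<in> hyp_plane"
    using s(1) ln by (intro lightlike_combination_in_hyp_plane) (simp_all add: a_def)
  have "?B \<inter> ?C = {} \<longleftrightarrow> a > 2"
  proof
    assume "?B \<inter> ?C = {}"
    with mid have "\<not> s * a \<le> 1" by (auto simp: lorentz_algebra nn nm)
    hence "(s * a)\<^sup>2 > 1" by (intro one_less_power) auto
    moreover have "(s * a)\<^sup>2 = a / 2"
      using a by (simp add: power_mult_distrib s(2)) (simp add: power2_eq_square)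
    ultimately show "a > 2" by simp
  next
    assume a2: "a > 2"
    show "?B \<inter> ?C = {}"
    proof (rule ccontr)
      assume "?B \<inter> ?C \<noteq> {}"
      then obtain x where x: "x \<in> hyp_plane" "- lorentz x n \<le> 1" "- lorentz x m \<le> 1" by blast
      \<comment> \<open>Pairing a common point with the midpoint bounds the sum of its two horoball
        functions from below by \<open>1 / s\<close>, which exceeds 2 if
        \<open>a > 2\<close>.\<close>
      have "1 \<le> s * (- lorentz x n - lorentz x m)"
        using lorentz_le_hyp_plane[OF x(1) mid] by (simp add: lorentz_algebra algebra_simps)
      also have "\<dots> \<le> s * 2" using x s(1) by (intro mult_left_mono) auto
      finally have "1 \<le> (s * 2)\<^sup>2" by (rule one_le_power)
      also have "\<dots> = 2 / a" by (simp add: power_mult_distrib s(2))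
      finally show False using a2 by (simp add: field_simps)
    qed
  qed
  \<comment> \<open>For \<open>a = 2\<close> the horoballs are tangent and fall into the negative
    branch, where the logarithm is 0.\<close>
  moreover have "\<bar>ln (a / 2)\<bar> = (if a > 2 then ln (a / 2) else - ln (a / 2))"
    using a by simp
  ultimately have "signed_horoball_dist \<xi> ?B \<eta> ?C = ln (a / 2)"
    unfolding signed_horoball_dist_def Let_def Inf by auto
  thus ?thesis using a by (simp add: a_def)
qed

section \<open>Length of a horocyclic segment\<close>

text \<open>Gives the uniqueness that the definite description in \<open>hyp_arc_length\<close>
  requires. Every arc with this image is a monotone reparametrisation \<open>u\<close> of the
  parabola \<open>c\<close>; its speed is \<open>T\<close> times the absolute derivative of
  \<open>u\<close>, and \<open>u\<close> runs over an interval of length 1.\<close>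

lemma hyp_length_horocyclic_path:
  fixes p v k :: minkowski and T :: real
  defines "c \<equiv> \<lambda>u. p + u *\<^sub>R v + u\<^sup>2 *\<^sub>R k"
  assumes T: "T > 0" and vv: "lorentz v v = T\<^sup>2" and vk: "lorentz v k = 0"
    and kk: "lorentz k k = 0" and pv: "lorentz p v = 0"
    and g: "arc g" "valid_path g" "path_image g = c ` {0..1}"
  shows "hyp_length g = T"
proof -
  \<comment> \<open>Pairing with \<open>v\<close> kills \<open>p\<close> and \<open>k\<close>, so it
    reads off the parameter of a point of the parabola. Being linear, it passes the regularity of
    \<open>g\<close> on to \<open>u\<close>.\<close>
  define u where "u = (\<lambda>t. lorentz (g t) v / T\<^sup>2)"
  have uc: "lorentz (c r) v / T\<^sup>2 = r" for r
    using T by (simp add: c_def lorentz_algebra pv vv lorentz_commute[of k v] vk)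
  have gu: "g t = c (u t)" and u01: "u t \<in> {0..1}" if t: "t \<in> {0..1}" for t
  proof -
    have "g t \<in> c ` {0..1}" using t g(3) by (auto simp: path_image_def)
    then obtain r where r: "r \<in> {0..1}" "g t = c r" by blast
    hence "u t = r" by (simp add: u_def uc)
    thus "g t = c (u t)" "u t \<in> {0..1}" using r by simp_all
  qed
  have surj: "\<exists>t\<in>{0..1}. u t = r" if r: "r \<in> {0..1}" for r
  proof -
    have "c r \<in> g ` {0..1}" using r g(3) by (auto simp: path_image_def)
    then obtain t where "t \<in> {0..1}" "c r = g t" by blast
    thus ?thesis using uc[of r] by (intro bexI[of _ t]) (simp_all add: u_def)
  qed
  have contg: "continuous_on {0..1} g" and injg: "inj_on g {0..1}"
    using g(1) by (simp_all add: arc_def path_def)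
  have contu: "continuous_on {0..1} u"
    unfolding u_def using T by (intro continuous_intros lorentz.continuous_on contg) auto
  have "inj_on u {0..1}"
    using injg gu by (metis (no_types, lifting) inj_on_def)
  hence "strict_mono_on {0..1} u \<or> strict_antimono_on {0..1} u"
    using injective_eq_monotone_map[OF is_interval_cc contu] by simp
  \<comment> \<open>The sign \<open>\<sigma>\<close> records the direction in which \<open>g\<close>
    runs through the segment, so that both directions are treated at once.\<close>
  then obtain \<sigma> :: real where \<sigma>: "\<bar>\<sigma>\<bar> = 1" "mono_on {0..1} (\<lambda>t. \<sigma> * u t)" "\<sigma> * u 1 - \<sigma> * u 0 = 1"
  proof
    assume "strict_mono_on {0..1} u"
    hence m: "u s \<le> u t" if "s \<in> {0..1}" "t \<in> {0..1}" "s \<le> t" for s t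
      using that by (meson monotone_onD strict_mono_on_imp_mono_on)
    obtain t0 t1 where "t0 \<in> {0..1}" "u t0 = 0" "t1 \<in> {0..1}" "u t1 = 1"
      using surj[of 0] surj[of 1] by auto
    hence "u 0 = 0" "u 1 = 1" using m[of 0 t0] m[of t1 1] u01[of 0] u01[of 1] by auto
    thus thesis using m by (intro that[of 1]) (auto simp: monotone_on_def)
  next
    assume "strict_antimono_on {0..1} u"
    hence m: "u t \<le> u s" if "s \<in> {0..1}" "t \<in> {0..1}" "s \<le> t" for s t
      using that unfolding monotone_on_def by (cases "s = t") (auto intro: less_imp_le)
    obtain t0 t1 where "t0 \<in> {0..1}" "u t0 = 0" "t1 \<in> {0..1}" "u t1 = 1"
      using surj[of 0] surj[of 1] by auto
    hence "u 0 = 1" "u 1 = 0" using m[of 0 t1] m[of t0 1] u01[of 0] u01[of 1] by auto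
    thus thesis using m by (intro that[of "-1"]) (auto simp: monotone_on_def)
  qed
  obtain S where S: "finite S" "g C1_differentiable_on ({0..1} - S)"
    using g(2) by (auto simp: valid_path_def piecewise_C1_differentiable_on_def)
  define g' d where "g' = (\<lambda>t. vector_derivative g (at t))" and "d = (\<lambda>t. lorentz (g' t) v / T\<^sup>2)"
  have derg: "(g has_vector_derivative g' t) (at t)" if "t \<in> {0..1} - S" for t
    using S(2) that by (simp add: C1_differentiable_on_eq g'_def vector_derivative_works)
  have deru: "(u has_real_derivative d t) (at t)" if "t \<in> {0..1} - S" for t
  proof -
    have "bounded_linear (\<lambda>x. lorentz x v / T\<^sup>2)"
      using lorentz.bounded_linear_left by (intro bounded_linear_divide[THEN bounded_linear_compose])
    from bounded_linear.has_vector_derivative[OF this derg[OF that]]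
    show ?thesis
      unfolding u_def d_def by (simp add: has_real_derivative_iff_has_vector_derivative)
  qed
  \<comment> \<open>Near such \<open>t\<close>, \<open>g\<close> is \<open>c\<close> composed with
    \<open>u\<close>. As \<open>k\<close> is null and orthogonal to \<open>v\<close>, only the
    \<open>v\<close> component of the velocity contributes to the speed. The endpoints are left out
    because the derivative is two-sided, while \<open>g\<close> is known only on the unit
    interval.\<close>
  have speed: "sqrt (lorentz (g' t) (g' t)) = T * \<sigma> * d t" if t: "t \<in> {0<..<1} - S" for t
  proof -
    have t': "t \<in> {0..1} - S" using t by auto
    have du: "(u has_vector_derivative d t) (at t)"
      using deru[OF t'] by (simp add: has_real_derivative_iff_has_vector_derivative)
    have du2: "((\<lambda>t. (u t)\<^sup>2) has_vector_derivative 2 * u t * d t) (at t)"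
      unfolding has_real_derivative_iff_has_vector_derivative[symmetric]
      by (rule derivative_eq_intros deru[OF t'] refl | simp)+
    have cu: "((\<lambda>t. c (u t)) has_vector_derivative d t *\<^sub>R v + (2 * u t * d t) *\<^sub>R k) (at t)"
      unfolding c_def
      using has_vector_derivative_add[OF has_vector_derivative_const[of p]
        has_vector_derivative_add[OF
          bounded_linear.has_vector_derivative[OF bounded_linear_scaleR_left du, of v]
          bounded_linear.has_vector_derivative[OF bounded_linear_scaleR_left du2, of k]]]
      by (simp add: add.assoc)
    have cg: "c (u s) = g s" if "s \<in> {0<..<1}" for s
      using gu[of s] that by simp
    have "(g has_vector_derivative d t *\<^sub>R v + (2 * u t * d t) *\<^sub>R k) (at t)"
      using t has_vector_derivative_transform_within_open[OF cu open_greaterThanLessThan _ cg]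
      by blast
    hence "g' t = d t *\<^sub>R v + (2 * u t * d t) *\<^sub>R k"
      unfolding g'_def by (rule vector_derivative_at)
    hence "lorentz (g' t) (g' t) = (T * d t)\<^sup>2"
      by (simp add: lorentz_algebra vv vk kk lorentz_commute[of k v] power2_eq_square)
    moreover have "\<sigma> * d t \<ge> 0"
    proof (rule mono_on_imp_deriv_nonneg[OF \<sigma>(2)])
      show "((\<lambda>t. \<sigma> * u t) has_real_derivative \<sigma> * d t) (at t)"
        by (rule DERIV_cmult[OF deru[OF t']])
      show "t \<in> interior {0..1}" using t by simp
    qed
    hence "\<bar>d t\<bar> = \<sigma> * d t" using \<sigma>(1) by (metis abs_mult abs_of_nonneg mult_1)
    ultimately show ?thesis using T by (simp add: abs_mult)
  qed
  have "((\<lambda>t. T * \<sigma> * d t) has_integral (T * \<sigma> * u 1 - T * \<sigma> * u 0)) {0..1}"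
  proof (rule fundamental_theorem_of_calculus_interior_strong[OF S(1)])
    show "((\<lambda>t. T * \<sigma> * u t) has_vector_derivative T * \<sigma> * d t) (at t)"
      if "t \<in> {0<..<1} - S" for t
      unfolding has_real_derivative_iff_has_vector_derivative[symmetric]
      using that by (intro DERIV_cmult deru) auto
  qed (auto intro!: continuous_intros contu)
  moreover have "T * \<sigma> * u 1 - T * \<sigma> * u 0 = T"
    using \<sigma>(3) by (simp add: mult.assoc flip: right_diff_distrib)
  ultimately have "((\<lambda>t. T * \<sigma> * d t) has_integral T) {0..1}" by simp
  hence "((\<lambda>t. sqrt (lorentz (g' t) (g' t))) has_integral T) {0..1}"
    by (rule has_integral_spike_finite[of "S \<union> {0, 1}", rotated 2]) (use S(1) speed in auto)
  thus ?thesis unfolding hyp_length_def g'_def by (rule integral_unique)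
qed

text \<open>The parabola itself is an admissible arc, which supplies existence; uniqueness of the
  length is the preceding lemma.\<close>

lemma hyp_arc_length_horocyclic_segment:
  fixes p v k :: minkowski and T :: real
  assumes T: "T > 0" and vv: "lorentz v v = T\<^sup>2" and vk: "lorentz v k = 0"
    and kk: "lorentz k k = 0" and pv: "lorentz p v = 0"
  shows "hyp_arc_length ((\<lambda>u. p + u *\<^sub>R v + u\<^sup>2 *\<^sub>R k) ` {0..1}) = T"
proof -
  define c where "c = (\<lambda>u. p + u *\<^sub>R v + u\<^sup>2 *\<^sub>R k)"
  have uc: "lorentz (c r) v / T\<^sup>2 = r" for r
    using T by (simp add: c_def lorentz_algebra pv vv lorentz_commute[of k v] vk)
  have "inj_on c {0..1}" by (rule inj_on_inverseI[of _ "\<lambda>x. lorentz x v / T\<^sup>2"]) (rule uc)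
  moreover have "continuous_on {0..1} c" unfolding c_def by (intro continuous_intros)
  ultimately have "arc c" by (simp add: arc_def path_def)
  moreover have "c C1_differentiable_on {0..1}"
    unfolding C1_differentiable_on_def
  proof (intro exI conjI ballI)
    have "((\<lambda>u::real. u\<^sup>2) has_vector_derivative 2 * u) (at u)" for u
      unfolding has_real_derivative_iff_has_vector_derivative[symmetric]
      by (rule derivative_eq_intros refl | simp)+
    from has_vector_derivative_add[OF has_vector_derivative_const[of p]
      has_vector_derivative_add[OF
        bounded_linear.has_vector_derivative[OF bounded_linear_scaleR_left
          has_vector_derivative_id, of v]
        bounded_linear.has_vector_derivative[OF bounded_linear_scaleR_left this, of k]]]
    show "(c has_vector_derivative v + (2 * u) *\<^sub>R k) (at u)" for u
      by (simp add: c_def add.assoc)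
    show "continuous_on {0..1} (\<lambda>u. v + (2 * u) *\<^sub>R k)" by (intro continuous_intros)
  qed
  hence "valid_path c" unfolding valid_path_def by (rule C1_differentiable_imp_piecewise)
  moreover have "path_image c = c ` {0..1}" by (simp add: path_image_def)
  moreover have "hyp_length g = T" if "arc g" "valid_path g" "path_image g = c ` {0..1}" for g
    using hyp_length_horocyclic_path[OF assms] that by (simp add: c_def)
  ultimately have "(THE l. \<exists>g. arc g \<and> valid_path g \<and> path_image g = c ` {0..1} \<and> hyp_length g = l) = T"
    by (intro the_equality) blast+
  thus ?thesis unfolding hyp_arc_length_def c_def .
qed

section \<open>The arc that an ideal triangle cuts out\<close>

text \<open>The Gram matrix has zero diagonal, so its determinant is twice the product of the three
  pairings and does not vanish. Independence in dimension 3 then gives coordinates with respect to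
  the vertices.\<close>

lemma null_vectors_span:
  fixes l m n x :: minkowski
  assumes "lorentz l l = 0" "lorentz m m = 0" "lorentz n n = 0"
    and "lorentz l m < 0" "lorentz l n < 0" "lorentz m n < 0"
  obtains \<alpha> \<beta> \<gamma> where "x = \<alpha> *\<^sub>R l + \<beta> *\<^sub>R m + \<gamma> *\<^sub>R n"
proof -
  have ne: "l \<noteq> m" "l \<noteq> n" "m \<noteq> n" using assms by auto
  have zero: "\<alpha> = 0 \<and> \<beta> = 0 \<and> \<gamma> = 0" if "\<alpha> *\<^sub>R l + \<beta> *\<^sub>R m + \<gamma> *\<^sub>R n = 0" for \<alpha> \<beta> \<gamma> :: real
  proof -
    have *: "lorentz (\<alpha> *\<^sub>R l + \<beta> *\<^sub>R m + \<gamma> *\<^sub>R n) y = 0" for y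
      unfolding that by (rule lorentz.zero_left)
    have e: "\<beta> * lorentz l m + \<gamma> * lorentz l n = 0" "\<alpha> * lorentz l m + \<gamma> * lorentz m n = 0"
      "\<alpha> * lorentz l n + \<beta> * lorentz m n = 0"
      using *[of l] *[of m] *[of n] assms(1-3)
      by (simp_all add: lorentz_algebra lorentz_commute[of m l] lorentz_commute[of n l]
        lorentz_commute[of n m])
    \<comment> \<open>This combination of the three equations eliminates \<open>\<beta>\<close> and
      \<open>\<gamma>\<close>.\<close>
    have "2 * \<alpha> * lorentz l m * lorentz l n =
        lorentz l n * (\<alpha> * lorentz l m + \<gamma> * lorentz m n)
        + lorentz l m * (\<alpha> * lorentz l n + \<beta> * lorentz m n)
        - lorentz m n * (\<beta> * lorentz l m + \<gamma> * lorentz l n)" by algebra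
    hence "\<alpha> = 0" using assms(4-6) unfolding e by simp
    thus ?thesis using e assms(4-6) by simp
  qed
  have "independent {l, m, n}"
  proof (rule independent_if_scalars_zero)
    fix f x assume "(\<Sum>x\<in>{l, m, n}. f x *\<^sub>R x) = 0" "x \<in> {l, m, n}"
    thus "f x = 0" using zero[of "f l" "f m" "f n"] ne by (auto simp: add.assoc)
  qed simp
  moreover have "card {l, m, n} = 3" using ne by simp
  moreover have "dim (UNIV :: minkowski set) = 3" by simp
  ultimately have "x \<in> span {l, m, n}"
    using card_ge_dim_independent[of "{l, m, n}" UNIV] by auto
  then obtain \<alpha> where "x - \<alpha> *\<^sub>R l \<in> span {m, n}" by (auto simp only: span_breakdown_eq)
  then obtain \<beta> where "x - \<alpha> *\<^sub>R l - \<beta> *\<^sub>R m \<in> span {n}" by (auto simp only: span_breakdown_eq)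
  then obtain \<gamma> where "x - \<alpha> *\<^sub>R l - \<beta> *\<^sub>R m = \<gamma> *\<^sub>R n" unfolding span_singleton by blast
  hence "x = \<alpha> *\<^sub>R l + \<beta> *\<^sub>R m + \<gamma> *\<^sub>R n" by (simp add: algebra_simps)
  thus thesis by (rule that)
qed

text \<open>The sign of the pairing with a light-like vector tells the two sheets apart: on the
  lower sheet, \<open>- x\<close> would violate \<open>lorentz_lightlike_neg\<close>.\<close>

lemma hyp_planeI:
  assumes "lorentz x x = -1" "lightlike n" "lorentz x n < 0"
  shows "x \<in> hyp_plane"
proof (rule ccontr)
  assume "x \<notin> hyp_plane"
  hence "fst x \<le> 0" using assms(1) by (simp add: hyp_plane_def)
  moreover have "fst x \<noteq> 0"
  proof
    assume "fst x = 0"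
    hence "snd x \<bullet> snd x = -1" using assms(1) by (simp add: lorentz_def)
    thus False using inner_ge_zero[of "snd x"] by linarith
  qed
  ultimately have "- x \<in> hyp_plane" using assms(1) by (simp add: hyp_plane_def lorentz_algebra)
  from lorentz_lightlike_neg[OF this assms(2)] assms(3) show False by (simp add: lorentz_algebra)
qed

text \<open>The arc is \<open>c\<close> on the unit interval. The sides ending at
  \<open>\<xi>\<close> confine the horocycle within the triangle to these parameters, and every
  connected part of the horocycle containing \<open>p\<close> and \<open>q\<close> attains them all.
  This also covers a horocycle that crosses the opposite side.\<close>

lemma hyp_arc_length_triangle:
  assumes ideal: "ideal_point \<xi>" "ideal_point \<eta>" "ideal_point \<zeta>"
    and distinct: "\<xi> \<noteq> \<eta>" "\<xi> \<noteq> \<zeta>" "\<eta> \<noteq> \<zeta>"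
    and mem: "l \<in> \<xi>" "m \<in> \<eta>" "n \<in> \<zeta>"
  shows "hyp_arc_length (horocyclic_arc (horocycle {x \<in> hyp_plane. - lorentz x l \<le> 1})
      (ideal_triangle \<xi> \<eta> \<zeta>)) = sqrt (2 * (- lorentz m n) / (lorentz l m * lorentz l n))"
proof -
  note l = ideal_point_eq_ray[OF ideal(1) mem(1)] and m = ideal_point_eq_ray[OF ideal(2) mem(2)]
    and n = ideal_point_eq_ray[OF ideal(3) mem(3)]
  define \<Delta> where "\<Delta> = ideal_triangle \<xi> \<eta> \<zeta>"
  define S where "S = {x \<in> hyp_plane. lorentz x l = -1}"
  define a b e where "a = - lorentz l m" and "b = - lorentz l n" and "e = - lorentz m n"
  have pos: "a > 0" "b > 0" "e > 0"
    using lorentz_ideal_points_neg ideal distinct mem by (auto simp: a_def b_def e_def)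
  have prods: "lorentz l l = 0" "lorentz m m = 0" "lorentz n n = 0"
    "lorentz l m = -a" "lorentz m l = -a" "lorentz l n = -b" "lorentz n l = -b"
    "lorentz m n = -e" "lorentz n m = -e"
    using l(1) m(1) n(1) by (simp_all add: lightlike_def a_def b_def e_def lorentz_commute)
  define T where "T = sqrt (2 * e / (a * b))"
  have T: "T > 0" "T\<^sup>2 = 2 * e / (a * b)" using pos by (simp_all add: T_def)
  define p q where "p = (1/2) *\<^sub>R l + (1/a) *\<^sub>R m" and "q = (1/2) *\<^sub>R l + (1/b) *\<^sub>R n"
  \<comment> \<open>With this multiple of \<open>l\<close>, the vector \<open>v = q - p - k\<close>
    is orthogonal to \<open>p\<close> and has square \<open>T\<^sup>2\<close>.\<close>
  define k where "k = (T\<^sup>2 / 2) *\<^sub>R l"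
  define v where "v = q - p - k"
  \<comment> \<open>horocycle through \<open>p = c 0\<close> and \<open>q = c 1\<close>, parametrised proportionally to arc length\<close>
  define c where "c = (\<lambda>u. p + u *\<^sub>R v + u\<^sup>2 *\<^sub>R k)"
  define f where "f = (\<lambda>x. lorentz x v / T\<^sup>2)"
  have pl: "lorentz p l = -1" "lorentz q l = -1" "lorentz l p = -1" "lorentz l q = -1"
    using pos by (simp_all add: p_def q_def lorentz_algebra prods)
  have pq: "lorentz p p = -1" "lorentz q q = -1" "lorentz p q = -1 - T\<^sup>2 / 2" "lorentz q p = -1 - T\<^sup>2 / 2"
    using pos by (simp_all add: p_def q_def lorentz_algebra prods T(2) field_simps)
  have lv: "lorentz l v = 0" "lorentz v l = 0"
    using pl by (simp_all add: v_def k_def lorentz_algebra prods)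
  have mv: "lorentz m v = 0" and nv: "lorentz n v = T\<^sup>2 * b"
    using pos by (simp_all add: v_def p_def q_def k_def lorentz_algebra prods T(2) field_simps)
  have vk: "lorentz v k = 0" "lorentz k v = 0" and kk: "lorentz k k = 0"
    using lv by (simp_all add: k_def lorentz_algebra prods)
  have pk: "lorentz p k = - T\<^sup>2 / 2" "lorentz k p = - T\<^sup>2 / 2"
    "lorentz q k = - T\<^sup>2 / 2" "lorentz k q = - T\<^sup>2 / 2"
    using pl by (simp_all add: k_def lorentz_algebra)
  have pv: "lorentz p v = 0" "lorentz v p = 0"
    by (simp_all add: v_def lorentz_algebra pq pk)
  have vv: "lorentz v v = T\<^sup>2" by (simp add: v_def lorentz_algebra pq pk kk)
  have c01: "c 0 = p" "c 1 = q" by (simp_all add: c_def v_def)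
  have cl: "lorentz (c u) l = -1" for u
    by (simp add: c_def lorentz_algebra pl lv k_def prods)
  have cc: "lorentz (c u) (c u) = -1" for u
    by (simp add: c_def lorentz_algebra pq pk kk vv vk pv power2_eq_square)
  have cS: "c u \<in> S" for u
    using hyp_planeI[OF cc l(1)] cl by (simp add: S_def)
  have fc: "f (c u) = u" for u
    using T(1) by (simp add: f_def c_def lorentz_algebra pv vv vk)
  \<comment> \<open>The horocycle equation and \<open>u = f x\<close> fix the coefficients of
    \<open>m\<close> and \<open>n\<close>, so \<open>x\<close> differs from \<open>c u\<close> by
    \<open>s\<close> times \<open>l\<close>. Then \<open>lorentz x x\<close> is
    \<open>-1 - 2 * s\<close>, which forces \<open>s = 0\<close>.\<close>
  have cf: "c (f x) = x" if x: "x \<in> S" for x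
  proof -
    obtain \<alpha> \<beta> \<gamma> where abc: "x = \<alpha> *\<^sub>R l + \<beta> *\<^sub>R m + \<gamma> *\<^sub>R n"
      using null_vectors_span[of l m n x] prods pos by auto
    define u where "u = f x"
    have u: "u = \<gamma> * b" using T(1) by (simp add: u_def f_def abc lorentz_algebra lv mv nv)
    have "\<beta> * a + \<gamma> * b = 1" using x by (simp add: S_def abc lorentz_algebra prods)
    hence \<beta>: "\<beta> = 1/a - u * (1/a)" and \<gamma>: "\<gamma> = u * (1/b)"
      using pos by (simp_all add: u field_simps)
    define s where "s = \<alpha> - (1/2 - u * (T\<^sup>2/2) + u\<^sup>2 * (T\<^sup>2/2))"
    have xs: "x = c u + s *\<^sub>R l"
      unfolding abc \<beta> \<gamma> c_def v_def p_def q_def k_def s_def by (simp add: algebra_simps)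
    have "lorentz x x = -1" using x by (simp add: S_def hyp_plane_def)
    hence "s = 0" unfolding xs
      by (simp add: lorentz_algebra cc cl lorentz_commute[of l "c u"] prods)
    thus ?thesis using xs by (simp add: u_def)
  qed
  \<comment> \<open>These half-spaces are bounded by the planes through \<open>l, m\<close> and
    through \<open>l, n\<close>, which carry the two sides at \<open>\<xi>\<close>. On
    \<open>S\<close> they say that \<open>f\<close> lies between 0 and 1.\<close>
  have hull: "lorentz x v \<ge> 0 \<and> lorentz x v \<le> - T\<^sup>2 * lorentz x l" if "x \<in> convex hull (\<xi> \<union> \<eta> \<union> \<zeta>)" for x
  proof -
    have "convex {x. lorentz x v \<ge> 0 \<and> lorentz x v \<le> - T\<^sup>2 * lorentz x l}"
    proof (rule convexI)
      fix x y :: minkowski and r s :: real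
      assume "x \<in> {x. lorentz x v \<ge> 0 \<and> lorentz x v \<le> - T\<^sup>2 * lorentz x l}"
        and "y \<in> {x. lorentz x v \<ge> 0 \<and> lorentz x v \<le> - T\<^sup>2 * lorentz x l}" and r: "r \<ge> 0" "s \<ge> 0"
      hence *: "lorentz x v \<ge> 0" "lorentz x v \<le> - T\<^sup>2 * lorentz x l"
        "lorentz y v \<ge> 0" "lorentz y v \<le> - T\<^sup>2 * lorentz y l" by auto
      show "r *\<^sub>R x + s *\<^sub>R y \<in> {x. lorentz x v \<ge> 0 \<and> lorentz x v \<le> - T\<^sup>2 * lorentz x l}"
        using mult_left_mono[OF *(2) r(1)] mult_left_mono[OF *(4) r(2)] * r
        by (simp add: lorentz_algebra algebra_simps)
    qed
    moreover have "\<xi> \<union> \<eta> \<union> \<zeta> \<subseteq> {x. lorentz x v \<ge> 0 \<and> lorentz x v \<le> - T\<^sup>2 * lorentz x l}"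
      unfolding l(2) m(2) n(2) using pos T(1)
      by (auto simp: lorentz_algebra lv mv nv prods mult_ac)
    ultimately show ?thesis using that hull_minimal[of "\<xi> \<union> \<eta> \<union> \<zeta>" _ convex] by blast
  qed
  have f01: "f x \<in> {0..1}" if "x \<in> S \<inter> \<Delta>" for x
    using hull[of x] that T(1) by (simp add: f_def S_def \<Delta>_def ideal_triangle_def)
  have inhull: "(1/2) *\<^sub>R l + s *\<^sub>R y \<in> convex hull (\<xi> \<union> \<eta> \<union> \<zeta>)"
    if y: "(2 * s) *\<^sub>R y \<in> \<eta> \<union> \<zeta>" for s y
  proof -
    have "(1/2) *\<^sub>R l + (1/2) *\<^sub>R ((2 * s) *\<^sub>R y) \<in> convex hull (\<xi> \<union> \<eta> \<union> \<zeta>)"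
      using mem(1) y by (intro convexD[OF convex_convex_hull] hull_inc) auto
    thus ?thesis by simp
  qed
  have "(2 * (1/a)) *\<^sub>R m \<in> \<eta> \<union> \<zeta>" unfolding m(2) using pos by auto
  moreover have "(2 * (1/b)) *\<^sub>R n \<in> \<eta> \<union> \<zeta>" unfolding n(2) using pos by auto
  ultimately have ends: "p \<in> S \<inter> \<Delta>" "q \<in> S \<inter> \<Delta>"
    using cS[of 0] cS[of 1] inhull[of "1/a" m] inhull[of "1/b" n] unfolding c01
    by (simp_all add: S_def \<Delta>_def ideal_triangle_def flip: p_def q_def)
  have "horocyclic_arc S \<Delta> = c ` {0..1}"
  proof
    have "connected (c ` {0..1})"
      unfolding c_def by (intro connected_continuous_image continuous_intros) simp
    moreover have "c ` {0..1} \<subseteq> S" using cS by blast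
    moreover have "S \<inter> \<Delta> \<subseteq> c ` {0..1}"
    proof
      fix x assume x: "x \<in> S \<inter> \<Delta>"
      hence "x = c (f x)" using cf by simp
      thus "x \<in> c ` {0..1}" using f01[OF x] by blast
    qed
    ultimately show "horocyclic_arc S \<Delta> \<subseteq> c ` {0..1}" unfolding horocyclic_arc_def by blast
    show "c ` {0..1} \<subseteq> horocyclic_arc S \<Delta>"
      unfolding horocyclic_arc_def
    proof (intro Inter_greatest subsetI, elim CollectE conjE imageE)
      fix C x u
      assume C: "connected C" "C \<subseteq> S" "S \<inter> \<Delta> \<subseteq> C" and u: "u \<in> {0..1}" "x = c u"
      \<comment> \<open>The image is an interval containing 0 and 1; since \<open>c\<close> inverts
        \<open>f\<close> on \<open>S\<close>, the point of \<open>C\<close> with parameter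
        \<open>u\<close> must be \<open>c u\<close>.\<close>
      have "connected (f ` C)"
        unfolding f_def using T(1) C(1)
        by (intro connected_continuous_image continuous_intros lorentz.continuous_on) auto
      moreover have "0 \<in> f ` C" "1 \<in> f ` C"
        using ends C(3) fc[of 0] fc[of 1] unfolding c01 by (metis image_eqI subsetD)+
      ultimately have "u \<in> f ` C"
        using u(1) connected_contains_Icc by blast
      then obtain y where y: "y \<in> C" "u = f y" by blast
      hence "c u = y" using cf[of y] C(2) by blast
      thus "x \<in> C" using y(1) u(2) by simp
    qed
  qed
  moreover have "horocycle {x \<in> hyp_plane. - lorentz x l \<le> 1} = S"
    unfolding S_def by (rule horocycle_horoball[OF l(1)])
  ultimately have "hyp_arc_length (horocyclic_arc (horocycle {x \<in> hyp_plane. - lorentz x l \<le> 1}) \<Delta>) = T"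
    using hyp_arc_length_horocyclic_segment[OF T(1) vv vk(1) kk pv(1)] by (simp add: c_def)
  thus ?thesis unfolding \<Delta>_def T_def by (simp add: a_def b_def e_def)
qed

section \<open>The three laws for horoballs at the vertices of an ideal triangle\<close>

theorem proposition2p3:
  fixes \<xi>1 \<xi>2 \<xi>3 B1 B2 B3 \<Delta> :: "minkowski set"
    and \<theta>1 \<theta>2 \<theta>3 d12 d13 d23 :: real
  assumes "ideal_point \<xi>1" "ideal_point \<xi>2" "ideal_point \<xi>3"
    and "\<xi>1 \<noteq> \<xi>2" "\<xi>1 \<noteq> \<xi>3" "\<xi>2 \<noteq> \<xi>3"
    and "\<Delta> = ideal_triangle \<xi>1 \<xi>2 \<xi>3"
    and "horoball \<xi>1 B1" "horoball \<xi>2 B2" "horoball \<xi>3 B3"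
    and "\<theta>1 = hyp_arc_length (horocyclic_arc (horocycle B1) \<Delta>)"
    and "\<theta>2 = hyp_arc_length (horocyclic_arc (horocycle B2) \<Delta>)"
    and "\<theta>3 = hyp_arc_length (horocyclic_arc (horocycle B3) \<Delta>)"
    and "d12 = signed_horoball_dist \<xi>1 B1 \<xi>2 B2"
    and "d13 = signed_horoball_dist \<xi>1 B1 \<xi>3 B3"
    and "d23 = signed_horoball_dist \<xi>2 B2 \<xi>3 B3"
  shows "(\<theta>1 / exp d23 = \<theta>2 / exp d13 \<and> \<theta>2 / exp d13 = \<theta>3 / exp d12)
    \<and> \<theta>1 = sqrt (exp d23 / (exp d12 * exp d13))
    \<and> exp d23 = 1 / (\<theta>2 * \<theta>3)"
proof -
  obtain n1 n2 n3 where n: "n1 \<in> \<xi>1" "n2 \<in> \<xi>2" "n3 \<in> \<xi>3"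
    and B: "B1 = {x \<in> hyp_plane. - lorentz x n1 \<le> 1}" "B2 = {x \<in> hyp_plane. - lorentz x n2 \<le> 1}"
      "B3 = {x \<in> hyp_plane. - lorentz x n3 \<le> 1}"
    using assms(8-10) by (auto simp: horoball_def)
  define a b e where "a = - lorentz n1 n2" and "b = - lorentz n1 n3" and "e = - lorentz n2 n3"
  have pos: "a > 0" "b > 0" "e > 0"
    using lorentz_ideal_points_neg assms(1-6) n by (auto simp: a_def b_def e_def)
  have d: "exp d12 = a / 2" "exp d13 = b / 2" "exp d23 = e / 2"
    using exp_signed_horoball_dist assms(1-6) n by (auto simp: assms(14-16) B a_def b_def e_def)
  \<comment> \<open>The arc length formula singles out the first vertex; the symmetry of the hull
    makes it available at the other two.\<close>
  have tri: "\<Delta> = ideal_triangle \<xi>2 \<xi>1 \<xi>3" "\<Delta> = ideal_triangle \<xi>3 \<xi>1 \<xi>2"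
    unfolding assms(7) ideal_triangle_def by (simp_all only: Un_ac)
  have "\<theta>1 = sqrt (2 * e / (a * b))"
    unfolding assms(11) B assms(7)
    by (subst hyp_arc_length_triangle[OF assms(1-3) _ _ _ n])
      (use assms(4-6) in \<open>simp_all add: a_def b_def e_def\<close>)
  moreover have "\<theta>2 = sqrt (2 * b / (a * e))"
    unfolding assms(12) B tri(1)
    by (subst hyp_arc_length_triangle[OF assms(2,1,3) _ _ _ n(2,1,3)])
      (use assms(4-6) in \<open>simp_all add: a_def b_def e_def lorentz_commute[of n2 n1]\<close>)
  moreover have "\<theta>3 = sqrt (2 * a / (b * e))"
    unfolding assms(13) B tri(2)
    by (subst hyp_arc_length_triangle[OF assms(3,1,2) _ _ _ n(3,1,2)])
      (use assms(4-6) in \<open>simp_all add: a_def b_def e_def lorentz_commute[of n3]\<close>)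
  \<comment> \<open>The symmetric factor \<open>r\<close> makes each \<open>\<theta>\<close> equal
    to \<open>r\<close> times the pairing that belongs to the opposite side, which removes the
    separate square roots.\<close>
  moreover define r where "r = sqrt (2 / (a * b * e))"
  have r: "r > 0" "r\<^sup>2 = 2 / (a * b * e)" using pos by (simp_all add: r_def)
  have rw: "sqrt (2 * z / w) = z * r" if "z > 0" "w * z = a * b * e" for z w
  proof (rule real_sqrt_unique)
    have "w \<noteq> 0" using that pos by auto
    thus "(z * r)\<^sup>2 = 2 * z / w"
      unfolding power_mult_distrib r(2) that(2)[symmetric] using that(1)
      by (simp add: power2_eq_square)
    show "0 \<le> z * r" using that r by simp
  qed
  ultimately have \<theta>: "\<theta>1 = e * r" "\<theta>2 = b * r" "\<theta>3 = a * r"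
    using rw[of e "a * b"] rw[of b "a * e"] rw[of a "b * e"] pos by (simp_all add: mult_ac)
  have cos1: "\<theta>1 = sqrt (exp d23 / (exp d12 * exp d13))"
    using rw[of e "a * b"] pos unfolding d \<theta> by (simp add: mult_ac)
  have cos2: "exp d23 = 1 / (\<theta>2 * \<theta>3)"
  proof -
    have "\<theta>2 * \<theta>3 = a * b * r\<^sup>2" unfolding \<theta> by (simp add: power2_eq_square)
    also have "\<dots> = 2 / e" unfolding r(2) using pos by simp
    finally show ?thesis by (simp add: d)
  qed
  have "\<theta>1 / exp d23 = 2 * r" "\<theta>2 / exp d13 = 2 * r" "\<theta>3 / exp d12 = 2 * r"
    unfolding d \<theta> using pos by simp_all
  thus ?thesis using cos1 cos2 by simp
qed

end
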